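(* Let $p \in [1,\infty]$, $B > 0$ and $b \in (0,\tfrac{1}{4B})$. Then, for all $f,g \in L^p([-B,B])$, the following are equivalent: 1. $f = \mathrm{e}^{\mathrm{i}\alpha} g$ for some $\alpha \in \mathbb{R}$; 2. $|\mathcal{G} f(x,\omega)| = |\mathcal{G} g(x,\omega)|$ for all $(x,\omega) \in \mathbb{N} \times b\mathbb{Z}$.
   Context: Functions are complex-valued. $L^p([-B,B])$ is regarded as the subspace of $L^p(\mathbb{R})$ of functions vanishing (almost everywhere) outside $[-B,B]$, and equality of functions is almost everywhere. For $f \in L^p(\mathbb{R})$, $p\in[1,\infty]$, the Gabor transform of $f$ is $$\mathcal{G} f (x,\omega) := 2^{1/4} \int_{\mathbb{R}} f(t)\, \mathrm{e}^{-\pi(t-x)^2} \mathrm{e}^{-2\pi \mathrm{i} t \omega}\, \mathrm{d}t, \qquad (x,\omega) \in \mathbb{R}^2.$$ $\mathbb{N}$ denotes the natural numbers and $b\mathbb{Z} = \{bk : k \in \mathbb{Z}\}$. *)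

theory Defs
  imports "HOL-Probability.Essential_Supremum"
begin

text \<open>
  Elements of \<open>L\<^sup>p(\<real>)\<close> are represented by Lebesgue measurable functions, without passing to
  equivalence classes; equality in \<open>L\<^sup>p\<close> is equality almost everywhere. The exponent lives in
  \<^typ>\<open>ennreal\<close> so that \<open>p = \<infinity>\<close> is covered as well; the definition is meant for \<open>1 \<le> p\<close>.
\<close>

definition Lp_space :: "ennreal \<Rightarrow> (real \<Rightarrow> complex) set" where
  "Lp_space p = {f \<in> borel_measurable lebesgue.
     if p = \<infinity> then esssup lebesgue (\<lambda>t. ennreal (norm (f t))) < \<infinity>
     else (\<integral>\<^sup>+ t. ennreal (norm (f t) powr enn2real p) \<partial>lebesgue) < \<infinity>}"

definition Lp_interval :: "ennreal \<Rightarrow> real \<Rightarrow> (real \<Rightarrow> complex) set" where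
  "Lp_interval p B = {f \<in> Lp_space p. AE t in lebesgue. t \<notin> {-B..B} \<longrightarrow> f t = 0}"

definition Gabor :: "(real \<Rightarrow> complex) \<Rightarrow> real \<Rightarrow> real \<Rightarrow> complex" where
  "Gabor f x \<omega> = complex_of_real (2 powr (1/4)) *
     (\<integral>t. f t * complex_of_real (exp (- pi * (t - x)\<^sup>2))
            * exp (- 2 * complex_of_real pi * \<i> * complex_of_real t * complex_of_real \<omega>) \<partial>lebesgue)"

end

theory Submission
  imports Defs
begin

text \<open>
  The phaseless samples are linear in the rank-one kernel \<open>f(u) cnj (f(t))\<close>, which determines \<open>f\<close> up
  to a constant phase. A function in \<open>L\<^sup>p\<close> with bounded support is integrable, so Fubini shows
  that \<open>|Gabor f x \<omega>|\<^sup>2\<close> is a constant times the integral over the plane of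
  \<open>f(u) cnj (f(t)) exp (-\<pi>((u-x)\<^sup>2 + (t-x)\<^sup>2)) exp (-2\<pi>i\<omega>(u-t))\<close>.
  For \<open>x = n\<close> the Gaussian is \<open>exp (-2\<pi>n\<^sup>2) exp (-\<pi>(u\<^sup>2 + t\<^sup>2)) exp (2\<pi>n(u+t))\<close>: it depends on \<open>n\<close> only
  through a constant and the \<open>n\<close>-th power of \<open>exp (2\<pi>(u+t))\<close>. Hence, if the samples of \<open>f\<close> and \<open>g\<close>
  agree, the function
  \<open>H(u,t) = (f(u) cnj (f(t)) - g(u) cnj (g(t))) exp (-\<pi>(u\<^sup>2 + t\<^sup>2) + 2\<pi>(u+t))\<close>,
  which lives on the square \<open>[-B,B]\<^sup>2\<close>, is orthogonal to all the functions
  \<open>exp (2\<pi>n(u+t)) exp (2\<pi>ibk(u-t))\<close> with \<open>n \<ge> 0\<close> and \<open>k\<close> an integer. They are closed under products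
  and conjugation, and they separate the points of the square: \<open>n = 1\<close>, \<open>k = 0\<close> recovers \<open>u+t\<close>, while
  \<open>n = 0\<close>, \<open>k = 1\<close> recovers \<open>u-t\<close> modulo \<open>1/b\<close>, hence \<open>u-t\<close> itself, because it ranges over
  an interval of length \<open>4B < 1/b\<close>. By Stone-Weierstrass their span is uniformly dense in the
  continuous functions on the square, so \<open>H = 0\<close> almost everywhere
  (\<open>AE_eq_0_if_exp_trig_moments_eq_0\<close>) and the two rank-one kernels coincide
  (\<open>AE_tensor_eq_if_Gabor_samples_eq\<close>). Comparing the rows of the two kernels yields the phase
  (\<open>AE_phase_if_AE_tensor_eq\<close>).

  Treating \<open>x\<close> and \<open>\<omega>\<close> together, by one density argument in two variables, replaces the two successive
  arguments that the samples suggest, namely Fourier series in \<open>u-t\<close> and Muentz-type completeness of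
  exponentials in \<open>u+t\<close>.
\<close>

section \<open>Integrable Borel representatives\<close>

text \<open>
  On a set of finite measure \<open>L\<^sup>p\<close> is contained in \<open>L\<^sup>1\<close>: for finite \<open>p\<close> because \<open>a \<le> 1 + a\<^sup>p\<close>, for
  \<open>p = \<infinity>\<close> because the essential supremum is an integrable majorant there.
\<close>

lemma integrable_if_Lp_interval:
  assumes "1 \<le> p" and "f \<in> Lp_interval p B"
  shows "integrable lebesgue f"
proof -
  have f [measurable]: "f \<in> borel_measurable lebesgue"
    and supp: "AE t in lebesgue. t \<notin> {-B..B} \<longrightarrow> f t = 0"
    using assms by (auto simp: Lp_interval_def Lp_space_def)
  have int1: "integrable lebesgue (\<lambda>t. c * indicator {-B..B} t :: real)" for c
    by (intro integrable_mult_right) (auto intro!: integrable_real_indicator simp: emeasure_lborel_Icc_eq)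
  show ?thesis
  proof (cases "p = \<infinity>")
    case True
    define c where "c = esssup lebesgue (\<lambda>t. ennreal (norm (f t)))"
    have "c < \<infinity>"
      using assms True by (auto simp: Lp_interval_def Lp_space_def c_def)
    have "AE t in lebesgue. norm (f t) \<le> enn2real c"
      using esssup_AE[of "\<lambda>t. ennreal (norm (f t))" lebesgue] unfolding c_def[symmetric]
    proof eventually_elim
      case (elim t)
      then show ?case
        using \<open>c < \<infinity>\<close> enn2real_mono[OF elim] by simp
    qed
    with supp have "AE t in lebesgue. norm (f t) \<le> norm (enn2real c * indicator {-B..B} t :: real)"
      by eventually_elim (auto simp: indicator_def)
    then show ?thesis
      by (rule Bochner_Integration.integrable_bound[OF int1 f])
  next
    case False
    define q where "q = enn2real p"
    have "1 \<le> q"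
      using assms(1) False unfolding q_def
      by (metis enn2real_1 enn2real_mono infinity_ennreal_def top.not_eq_extremum)
    have "(\<integral>\<^sup>+ t. ennreal (norm (f t) powr q) \<partial>lebesgue) < \<infinity>"
      using assms False by (auto simp: Lp_interval_def Lp_space_def q_def)
    then have "integrable lebesgue (\<lambda>t. norm (f t) powr q)"
      by (intro integrableI_nonneg) auto
    then have int2: "integrable lebesgue (\<lambda>t. 1 * indicator {-B..B} t + norm (f t) powr q)"
      by (intro Bochner_Integration.integrable_add int1)
    have le: "a \<le> 1 + a powr q" if "0 \<le> a" for a :: real
    proof (cases "a \<le> 1")
      case True
      then show ?thesis using powr_ge_zero[of a q] by linarith
    next
      case False
      then show ?thesis using \<open>1 \<le> q\<close> powr_mono[of 1 q a] by simp
    qed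
    from supp have "AE t in lebesgue. norm (f t) \<le> norm (1 * indicator {-B..B} t + norm (f t) powr q)"
    proof eventually_elim
      case (elim t)
      show ?case
      proof (cases "t \<in> {-B..B}")
        case True
        have "norm (f t) \<le> 1 + norm (f t) powr q" using le by simp
        then show ?thesis using True by (simp add: abs_of_nonneg)
      next
        case False
        then show ?thesis using elim by simp
      qed
    qed
    then show ?thesis
      by (rule Bochner_Integration.integrable_bound[OF int2 f])
  qed
qed

text \<open>
  Lebesgue measurability is not inherited by products of functions of separate variables with
  respect to the product of Borel measures. A Borel representative that vanishes everywhere outside
  the interval makes Fubini on the plane available, and makes the support condition pointwise.
\<close>

lemma borel_representative_on_interval:
  fixes f :: "real \<Rightarrow> complex"
  assumes int: "integrable lebesgue f" and supp: "AE t in lebesgue. t \<notin> {-B..B} \<longrightarrow> f t = 0"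
  obtains F where "F \<in> borel_measurable borel" "integrable lborel F"
    "\<And>t. t \<notin> {-B..B} \<Longrightarrow> F t = 0" "AE t in lebesgue. f t = F t"
proof -
  have f: "f \<in> borel_measurable (completion lborel)"
    using int by simp
  obtain u where u [measurable]: "u \<in> borel_measurable lborel" "AE t in lborel. Re (f t) = u t"
    using completion_ex_borel_measurable_real[of "\<lambda>t. Re (f t)" lborel] f by auto
  obtain v where v [measurable]: "v \<in> borel_measurable lborel" "AE t in lborel. Im (f t) = v t"
    using completion_ex_borel_measurable_real[of "\<lambda>t. Im (f t)" lborel] f by auto
  define F where "F t = indicator {-B..B} t * Complex (u t) (v t)" for t
  have F [measurable]: "F \<in> borel_measurable borel"
    using u(1) v(1) unfolding F_def Complex_eq by measurable
  have ae: "AE t in lebesgue. f t = F t"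
    using AE_completion[OF u(2)] AE_completion[OF v(2)] supp
  proof eventually_elim
    case (elim t)
    then show ?case by (auto simp: F_def indicator_def complex_eq_iff)
  qed
  have "F \<in> borel_measurable lebesgue"
    by (intro measurable_completion) simp
  then have "integrable lebesgue F"
    using int ae integrable_cong_AE[of f lebesgue F] f by auto
  then have "integrable lborel F"
    by (simp add: integrable_completion)
  then show ?thesis
    using F ae by (intro that[of F]) (auto simp: F_def)
qed

section \<open>Functions orthogonal to a separating family\<close>

lemma integrable_mult_continuous_compact_support:
  fixes H \<phi> :: "'a::euclidean_space \<Rightarrow> complex"
  assumes H: "integrable lborel H" "compact K" "\<And>z. z \<notin> K \<Longrightarrow> H z = 0" and \<phi>: "continuous_on UNIV \<phi>"
  shows "integrable lborel (\<lambda>z. H z * \<phi> z)"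
proof -
  have [measurable]: "H \<in> borel_measurable borel" "\<phi> \<in> borel_measurable borel"
    using H \<phi> by (auto intro: borel_measurable_continuous_onI)
  have "bounded (\<phi> ` K)"
    using H \<phi> by (intro compact_imp_bounded compact_continuous_image) (auto intro: continuous_on_subset)
  then obtain C where C: "\<And>z. z \<in> K \<Longrightarrow> norm (\<phi> z) \<le> C"
    unfolding bounded_iff by auto
  show ?thesis
  proof (rule Bochner_Integration.integrable_bound)
    show "integrable lborel (\<lambda>z. C * norm (H z))"
      using H by auto
    show "AE z in lborel. norm (H z * \<phi> z) \<le> norm (C * norm (H z))"
    proof (rule AE_I2)
      fix z
      show "norm (H z * \<phi> z) \<le> norm (C * norm (H z))"
      proof (cases "z \<in> K")
        case True
        have "norm (H z) * norm (\<phi> z) \<le> norm (H z) * C"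
          by (rule mult_left_mono[OF C[OF True]]) simp
        also have "\<dots> \<le> norm (C * norm (H z))"
          by (metis abs_ge_self mult.commute real_norm_def)
        finally show ?thesis by (simp add: norm_mult)
      qed (use H in auto)
    qed
  qed measurable
qed

text \<open>
  The closed sets are an intersection-stable generator of the Borel sets, so Dynkin's argument
  extends the hypothesis to all Borel sets; the whole space, needed for complements, is closed.
\<close>

lemma AE_eq_0_if_closed_integrals_eq_0:
  fixes H :: "'a::euclidean_space \<Rightarrow> complex"
  assumes H: "integrable lborel H" and zero: "\<And>C. closed C \<Longrightarrow> (LINT z:C|lborel. H z) = 0"
  shows "AE z in lborel. H z = 0"
proof (rule sigma_finite_measure.density_zero[OF lborel.sigma_finite_measure_axioms H])
  have set_int: "set_integrable lborel A H" if "A \<in> sets borel" for A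
    unfolding set_integrable_def using that H by (intro integrable_mult_indicator) auto
  fix A :: "'a set"
  assume "A \<in> sets lborel"
  then have A: "A \<in> sigma_sets UNIV (Collect closed)"
    by (simp add: borel_eq_closed)
  have "Int_stable (Collect closed :: 'a set set)"
    by (auto simp: Int_stable_def)
  moreover have "Collect closed \<subseteq> Pow (UNIV :: 'a set)"
    by simp
  ultimately show "(LINT z:A|lborel. H z) = 0"
  using A
  proof (induction rule: sigma_sets_induct_disjoint)
    case (compl A)
    then have A: "A \<in> sets borel"
      by (simp add: borel_eq_closed)
    have "(LINT z:A \<union> (UNIV - A)|lborel. H z) = (LINT z:A|lborel. H z) + (LINT z:UNIV - A|lborel. H z)"
      by (rule set_integral_Un) (use A set_int in auto)
    then show ?case
      using compl zero[of UNIV] by simp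
  next
    case (union A)
    then have A: "A i \<in> sets borel" for i
      by (auto simp: borel_eq_closed)
    have "(LINT z:(\<Union>i. A i)|lborel. H z) = (\<Sum>i. LINT z:A i|lborel. H z)"
      using union A by (intro lebesgue_integral_countable_add set_int) (auto simp: disjoint_family_on_def)
    then show ?case using union by simp
  qed (use zero in \<open>auto simp: set_lebesgue_integral_def\<close>)
qed

text \<open>
  The indicator of a closed set is a pointwise limit of continuous functions with values in \<open>[0,1]\<close>,
  namely of steeper and steeper cut-offs of the distance to the set, so dominated convergence applies.
\<close>

lemma AE_eq_0_if_continuous_integrals_eq_0:
  fixes H :: "'a::euclidean_space \<Rightarrow> complex"
  assumes H: "integrable lborel H"
    and zero: "\<And>\<phi> :: 'a \<Rightarrow> real. continuous_on UNIV \<phi> \<Longrightarrow> (\<integral>z. H z * of_real (\<phi> z) \<partial>lborel) = 0"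
  shows "AE z in lborel. H z = 0"
proof (rule AE_eq_0_if_closed_integrals_eq_0[OF H])
  fix C :: "'a set"
  assume C: "closed C"
  have [measurable]: "H \<in> borel_measurable borel"
    using H by auto
  show "(LINT z:C|lborel. H z) = 0"
  proof (cases "C = {}")
    case False
    define \<phi> where "\<phi> n z = max 0 (1 - real n * infdist z C)" for n z
    have cont: "continuous_on UNIV (\<phi> n)" for n
      unfolding \<phi>_def by (intro continuous_intros)
    then have [measurable]: "\<phi> n \<in> borel_measurable borel" for n
      by (rule borel_measurable_continuous_onI)
    have lim: "(\<lambda>n. \<phi> n z) \<longlonglongrightarrow> indicator C z" for z
    proof (cases "z \<in> C")
      case True
      then show ?thesis by (simp add: \<phi>_def)
    next
      case False
      then have "infdist z C > 0"
        using C \<open>C \<noteq> {}\<close> infdist_pos_not_in_closed by blast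
      then obtain N where N: "1 < real N * infdist z C"
        using reals_Archimedean3 by blast
      have "\<phi> n z = 0" if "n \<ge> N" for n
      proof -
        have "real N * infdist z C \<le> real n * infdist z C"
          using that by (intro mult_right_mono) (auto simp: infdist_nonneg)
        then show ?thesis using N by (simp add: \<phi>_def)
      qed
      then have "\<forall>\<^sub>F n in sequentially. \<phi> n z = 0"
        unfolding eventually_sequentially by blast
      then show ?thesis using False by (simp add: tendsto_eventually)
    qed
    have "(\<lambda>n. \<integral>z. H z * of_real (\<phi> n z) \<partial>lborel) \<longlonglongrightarrow> (\<integral>z. H z * of_real (indicator C z) \<partial>lborel)"
    proof (rule integral_dominated_convergence)
      show "integrable lborel (\<lambda>z. norm (H z))" using H by simp
      show "AE z in lborel. (\<lambda>n. H z * of_real (\<phi> n z)) \<longlonglongrightarrow> H z * of_real (indicator C z)"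
        by (intro AE_I2 tendsto_intros lim)
      have "\<bar>\<phi> n z\<bar> \<le> 1" for n z
        by (auto simp: \<phi>_def infdist_nonneg abs_if max_def)
      then show "AE z in lborel. norm (H z * of_real (\<phi> n z)) \<le> norm (H z)" for n
        by (auto simp: norm_mult intro!: AE_I2 mult_left_le)
      show "(\<lambda>z. H z * complex_of_real (indicator C z)) \<in> borel_measurable lborel"
        using C by (intro borel_measurable_times borel_measurable_of_real borel_measurable_indicator) auto
      show "(\<lambda>z. H z * complex_of_real (\<phi> n z)) \<in> borel_measurable lborel" for n
        by simp
    qed
    then have "(\<integral>z. H z * of_real (indicator C z) \<partial>lborel) = 0"
      using zero[OF cont] by (simp add: LIMSEQ_const_iff)
    then show ?thesis
      by (simp add: set_lebesgue_integral_def scaleR_conv_of_real mult.commute)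
  qed (simp add: set_lebesgue_integral_def)
qed

text \<open>
  The real Stone-Weierstrass theorem requires an algebra of real functions. Forming the span of the
  real and imaginary parts of \<open>E\<close> would mean expanding products of linear combinations. Instead, let
  \<open>V\<close> be the space of continuous \<open>\<psi>\<close> for which \<open>H \<psi>\<close> is orthogonal to \<open>E\<close>, and take for \<open>R\<close> the
  real multipliers of \<open>V\<close>. Multipliers of any space form an algebra. Since \<open>E\<close> is closed
  under products, \<open>V\<close> is stable under multiplication by elements of \<open>E\<close> and by their conjugates, so
  \<open>R\<close> contains their real and imaginary parts and separates points. Since \<open>1 \<in> V\<close>, all of \<open>R\<close> is
  orthogonal to \<open>H\<close>, and by density so is every continuous function.
\<close>

lemma AE_eq_0_if_orthogonal_to_separating_monoid:
  fixes H :: "'a::euclidean_space \<Rightarrow> complex" and E :: "('a \<Rightarrow> complex) set"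
  assumes H: "integrable lborel H" "compact K" "\<And>z. z \<notin> K \<Longrightarrow> H z = 0"
    and cont: "\<And>e. e \<in> E \<Longrightarrow> continuous_on UNIV e"
    and one_mem: "(\<lambda>_. 1) \<in> E"
    and mult: "\<And>e e'. e \<in> E \<Longrightarrow> e' \<in> E \<Longrightarrow> (\<lambda>z. e z * e' z) \<in> E"
    and cnj: "\<And>e. e \<in> E \<Longrightarrow> (\<lambda>z. cnj (e z)) \<in> E"
    and separating: "\<And>x y. x \<in> K \<Longrightarrow> y \<in> K \<Longrightarrow> x \<noteq> y \<Longrightarrow> \<exists>e\<in>E. e x \<noteq> e y"
    and zero: "\<And>e. e \<in> E \<Longrightarrow> (\<integral>z. H z * e z \<partial>lborel) = 0"
  shows "AE z in lborel. H z = 0"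
proof (rule AE_eq_0_if_continuous_integrals_eq_0[OF H(1)])
  note int = integrable_mult_continuous_compact_support[OF H]
  define V where "V = {\<psi> :: 'a \<Rightarrow> complex. continuous_on UNIV \<psi> \<and> (\<forall>e\<in>E. (\<integral>z. H z * (\<psi> z * e z) \<partial>lborel) = 0)}"
  define R where "R = {\<phi> :: 'a \<Rightarrow> real. continuous_on UNIV \<phi> \<and> (\<forall>\<psi>\<in>V. (\<lambda>z. of_real (\<phi> z) * \<psi> z) \<in> V)}"
  have V_lin: "(\<lambda>z. a * \<psi> z + c * \<eta> z) \<in> V" if "\<psi> \<in> V" "\<eta> \<in> V" for a c \<psi> \<eta>
  proof -
    have "(\<integral>z. H z * ((a * \<psi> z + c * \<eta> z) * e z) \<partial>lborel) = 0" if "e \<in> E" for e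
    proof -
      have i: "integrable lborel (\<lambda>z. H z * (\<psi> z * e z))" "integrable lborel (\<lambda>z. H z * (\<eta> z * e z))"
        using \<open>\<psi> \<in> V\<close> \<open>\<eta> \<in> V\<close> cont[OF that] by (auto simp: V_def intro!: int continuous_intros)
      have "(\<integral>z. H z * ((a * \<psi> z + c * \<eta> z) * e z) \<partial>lborel)
          = (\<integral>z. a * (H z * (\<psi> z * e z)) + c * (H z * (\<eta> z * e z)) \<partial>lborel)"
        by (simp add: algebra_simps)
      also have "\<dots> = a * (\<integral>z. H z * (\<psi> z * e z) \<partial>lborel) + c * (\<integral>z. H z * (\<eta> z * e z) \<partial>lborel)"
        using i by (simp add: Bochner_Integration.integral_add)
      finally show ?thesis
        using \<open>\<psi> \<in> V\<close> \<open>\<eta> \<in> V\<close> that by (simp add: V_def)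
    qed
    then show ?thesis
      using that by (auto simp: V_def intro!: continuous_intros)
  qed
  have V_mult: "(\<lambda>z. e z * \<psi> z) \<in> V" if "e \<in> E" "\<psi> \<in> V" for e \<psi>
    using that mult[OF that(1)] cont[OF that(1)]
    by (fastforce simp: V_def mult_ac intro!: continuous_intros)
  have Re_R: "(\<lambda>z. Re (e z)) \<in> R" if "e \<in> E" for e
  proof -
    have "(\<lambda>z. of_real (Re (e z)) * \<psi> z) \<in> V" if "\<psi> \<in> V" for \<psi>
    proof -
      have "(\<lambda>z. of_real (Re (e z)) * \<psi> z) = (\<lambda>z. (1/2) * (e z * \<psi> z) + (1/2) * (cnj (e z) * \<psi> z))"
        by (auto simp: complex_eq_iff field_simps)
      then show ?thesis
        using V_lin[OF V_mult[OF \<open>e \<in> E\<close> that] V_mult[OF cnj[OF \<open>e \<in> E\<close>] that]] by presburger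
    qed
    then show ?thesis
      using cont[OF that] by (auto simp: R_def intro!: continuous_intros)
  qed
  have Im_R: "(\<lambda>z. Im (e z)) \<in> R" if "e \<in> E" for e
  proof -
    have "(\<lambda>z. of_real (Im (e z)) * \<psi> z) \<in> V" if "\<psi> \<in> V" for \<psi>
    proof -
      have "(\<lambda>z. of_real (Im (e z)) * \<psi> z) = (\<lambda>z. (-\<i>/2) * (e z * \<psi> z) + (\<i>/2) * (cnj (e z) * \<psi> z))"
        by (auto simp: complex_eq_iff field_simps)
      then show ?thesis
        using V_lin[OF V_mult[OF \<open>e \<in> E\<close> that] V_mult[OF cnj[OF \<open>e \<in> E\<close>] that]] by presburger
    qed
    then show ?thesis
      using cont[OF that] by (auto simp: R_def intro!: continuous_intros)
  qed
  interpret function_ring_on R K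
  proof
    show "compact K" by fact
    show "continuous_on K \<phi>" if "\<phi> \<in> R" for \<phi>
      using that by (auto simp: R_def intro: continuous_on_subset)
    show "(\<lambda>_. c) \<in> R" for c
      using V_lin[of _ _ "of_real c" 0] by (auto simp: R_def intro!: continuous_intros)
    show "(\<lambda>z. \<phi> z + \<phi>' z) \<in> R" if "\<phi> \<in> R" "\<phi>' \<in> R" for \<phi> \<phi>'
    proof -
      have "(\<lambda>z. of_real (\<phi> z + \<phi>' z) * \<psi> z) \<in> V" if "\<psi> \<in> V" for \<psi>
        using V_lin[of "\<lambda>z. of_real (\<phi> z) * \<psi> z" "\<lambda>z. of_real (\<phi>' z) * \<psi> z" 1 1] \<open>\<phi> \<in> R\<close> \<open>\<phi>' \<in> R\<close> that
        by (simp add: R_def distrib_right)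
      then show ?thesis using that by (auto simp: R_def intro!: continuous_intros)
    qed
    show "(\<lambda>z. \<phi> z * \<phi>' z) \<in> R" if "\<phi> \<in> R" "\<phi>' \<in> R" for \<phi> \<phi>'
      using that by (auto simp: R_def mult.assoc intro!: continuous_intros)
    show "\<exists>\<phi>\<in>R. \<phi> x \<noteq> \<phi> y" if xy: "x \<in> K" "y \<in> K" "x \<noteq> y" for x y
    proof -
      obtain e where "e \<in> E" "e x \<noteq> e y"
        using separating[OF xy] by blast
      then have "Re (e x) \<noteq> Re (e y) \<or> Im (e x) \<noteq> Im (e y)"
        by (simp add: complex_eq_iff)
      then show ?thesis
        using Re_R[OF \<open>e \<in> E\<close>] Im_R[OF \<open>e \<in> E\<close>] by (elim disjE bexI[rotated])
    qed
  qed
  have R_zero: "(\<integral>z. H z * of_real (\<phi> z) \<partial>lborel) = 0" if "\<phi> \<in> R" for \<phi>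
  proof -
    have "(\<lambda>_. 1) \<in> V"
      using zero by (auto simp: V_def)
    moreover have "\<forall>\<psi>\<in>V. (\<lambda>z. of_real (\<phi> z) * \<psi> z) \<in> V"
      using that by (simp add: R_def)
    ultimately have "(\<lambda>z. of_real (\<phi> z) * 1) \<in> V"
      by (rule bspec[rotated])
    then have "\<forall>e\<in>E. (\<integral>z. H z * (of_real (\<phi> z) * 1 * e z) \<partial>lborel) = 0"
      by (simp add: V_def)
    from bspec[OF this one_mem] show ?thesis by simp
  qed
  fix \<phi> :: "'a \<Rightarrow> real"
  assume \<phi>: "continuous_on UNIV \<phi>"
  define N where "N = (\<integral>z. norm (H z) \<partial>lborel)"
  have "norm (\<integral>z. H z * of_real (\<phi> z) \<partial>lborel) \<le> 0 + \<epsilon>" if "\<epsilon> > 0" for \<epsilon>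
  proof -
    have "N \<ge> 0" by (simp add: N_def)
    \<comment> \<open>The summand 1 keeps the quotient meaningful when \<open>H\<close> has integral norm 0.\<close>
    define \<delta> where "\<delta> = \<epsilon> / (N + 1)"
    have "\<delta> > 0"
      using that \<open>N \<ge> 0\<close> by (auto simp: \<delta>_def intro!: divide_pos_pos)
    then obtain \<eta> where \<eta>: "\<eta> \<in> R" "\<And>z. z \<in> K \<Longrightarrow> \<bar>\<phi> z - \<eta> z\<bar> < \<delta>"
      using Stone_Weierstrass_basic[OF continuous_on_subset[OF \<phi>]] by blast
    have cont_\<eta>: "continuous_on UNIV \<eta>"
      using \<eta> by (simp add: R_def)
    have i: "integrable lborel (\<lambda>z. H z * of_real (h z))" if "continuous_on UNIV h" for h :: "'a \<Rightarrow> real"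
      using that by (intro int continuous_on_of_real)
    note i = i[OF \<phi>] i[OF cont_\<eta>]
    have "norm (\<integral>z. H z * of_real (\<phi> z) \<partial>lborel) = norm (\<integral>z. H z * of_real (\<phi> z) - H z * of_real (\<eta> z) \<partial>lborel)"
      using i R_zero[OF \<eta>(1)] by (simp add: Bochner_Integration.integral_diff)
    also have "\<dots> \<le> (\<integral>z. \<delta> * norm (H z) \<partial>lborel)"
    proof (rule Bochner_Integration.integral_norm_bound_integral)
      show "norm (H z * of_real (\<phi> z) - H z * of_real (\<eta> z)) \<le> \<delta> * norm (H z)" for z
      proof (cases "z \<in> K")
        case True
        have "norm (H z * of_real (\<phi> z) - H z * of_real (\<eta> z)) = norm (H z) * \<bar>\<phi> z - \<eta> z\<bar>"
          by (metis norm_mult norm_of_real of_real_diff right_diff_distrib)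
        also have "\<dots> \<le> norm (H z) * \<delta>"
          using \<eta>(2)[OF True] by (intro mult_left_mono) auto
        finally show ?thesis by (simp add: mult.commute)
      qed (use H in auto)
    qed (use i H in auto)
    also have "\<dots> = \<epsilon> * (N / (N + 1))"
      by (simp add: \<delta>_def N_def)
    also have "\<dots> \<le> \<epsilon> * 1"
      using that \<open>N \<ge> 0\<close> by (intro mult_left_mono) (auto simp: divide_le_eq_1)
    finally show ?thesis by simp
  qed
  then have "norm (\<integral>z. H z * of_real (\<phi> z) \<partial>lborel) \<le> 0"
    by (rule field_le_epsilon)
  then show "(\<integral>z. H z * of_real (\<phi> z) \<partial>lborel) = 0" by simp
qed

text \<open>
  The sampling density enters here: the differences \<open>u - t\<close> of points of the square fill an interval
  of length \<open>4B\<close>, and the character \<open>exp (2\<pi>ib(u - t))\<close> is injective on it when \<open>4Bb < 1\<close>.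
\<close>

lemma AE_eq_0_if_exp_trig_moments_eq_0:
  fixes H :: "real \<times> real \<Rightarrow> complex"
  assumes H: "integrable lborel H" "\<And>z. z \<notin> {-B..B} \<times> {-B..B} \<Longrightarrow> H z = 0"
    and b: "0 < b" "4 * B * b < 1"
    and zero: "\<And>(n::nat) (k::int). (\<integral>z. H z * (of_real (exp (2 * pi * real n * (fst z + snd z)))
              * cis (2 * pi * b * of_int k * (fst z - snd z))) \<partial>lborel) = 0"
  shows "AE z in lborel. H z = 0"
proof -
  define e :: "nat \<Rightarrow> int \<Rightarrow> real \<times> real \<Rightarrow> complex" where
    "e n k z = of_real (exp (2 * pi * real n * (fst z + snd z))) * cis (2 * pi * b * of_int k * (fst z - snd z))" for n k z
  show ?thesis
  proof (rule AE_eq_0_if_orthogonal_to_separating_monoid[where K = "{-B..B} \<times> {-B..B}" and E = "{e n k |n k. True}"])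
    show "compact ({-B..B} \<times> {-B..B})"
      by (intro compact_Times compact_Icc)
    show "continuous_on UNIV f" if "f \<in> {e n k |n k. True}" for f
      using that by (auto simp: e_def[abs_def] intro!: continuous_intros)
    show "(\<lambda>_. 1) \<in> {e n k |n k. True}"
      by (auto simp: e_def[abs_def] intro!: exI[of _ 0])
    show "(\<lambda>z. f z * f' z) \<in> {e n k |n k. True}"
      if ff': "f \<in> {e n k |n k. True}" "f' \<in> {e n k |n k. True}" for f f'
    proof -
      obtain n k n' k' where "f = e n k" "f' = e n' k'"
        using ff' by blast
      then have "(\<lambda>z. f z * f' z) = e (n + n') (k + k')"
        by (auto simp: e_def fun_eq_iff cis_mult exp_add algebra_simps simp flip: of_real_mult)
      then show ?thesis by blast
    qed
    show "(\<lambda>z. cnj (f z)) \<in> {e n k |n k. True}" if f: "f \<in> {e n k |n k. True}" for f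
    proof -
      obtain n k where "f = e n k"
        using f by blast
      then have "(\<lambda>z. cnj (f z)) = e n (- k)"
        by (auto simp: e_def fun_eq_iff cis_cnj)
      then show ?thesis by blast
    qed
    show "\<exists>f\<in>{e n k |n k. True}. f x \<noteq> f y"
      if xy: "x \<in> {-B..B} \<times> {-B..B}" "y \<in> {-B..B} \<times> {-B..B}" "x \<noteq> y" for x y
    proof (rule ccontr)
      assume "\<not> ?thesis"
      then have eq: "e n k x = e n k y" for n k
        by blast
      have sum: "fst x + snd x = fst y + snd y"
        using eq[of 1 0] by (simp add: e_def)
      define dx dy where "dx = fst x - snd x" and "dy = fst y - snd y"
      have "cis (2 * pi * b * dx) = cis (2 * pi * b * dy)"
        using eq[of 0 1] by (simp add: e_def dx_def dy_def)
      then have "cis (2 * pi * (b * (dx - dy))) = 1"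
        by (simp add: right_diff_distrib mult.assoc flip: cis_divide)
      then have "cos (2 * pi * (b * (dx - dy))) = 1"
        by (metis cis.sel(1) one_complex.sel(1))
      then obtain m :: int where "2 * pi * (b * (dx - dy)) = of_int m * 2 * pi"
        using cos_one_2pi_int by blast
      then have m: "b * (dx - dy) = of_int m"
        by simp
      have "\<bar>dx - dy\<bar> \<le> 4 * B"
        using xy by (auto simp: dx_def dy_def mem_Times_iff)
      then have "b * \<bar>dx - dy\<bar> \<le> b * (4 * B)"
        using b by (intro mult_left_mono) auto
      also have "\<dots> < 1"
        using b by (simp add: mult_ac)
      finally have "\<bar>b * (dx - dy)\<bar> < 1"
        using b by (simp add: abs_mult)
      then have "m = 0"
        unfolding m by linarith
      then have "dx = dy"
        using m b by simp
      then have "x = y"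
        using sum by (auto simp: dx_def dy_def prod_eq_iff)
      with xy show False by simp
    qed
    show "(\<integral>z. H z * f z \<partial>lborel) = 0" if "f \<in> {e n k |n k. True}" for f
      using that zero by (auto simp: e_def)
  qed (use H in auto)
qed

section \<open>Rank-one kernels determine a function up to phase\<close>

text \<open>
  A row of the kernel at a point where, say, \<open>f\<close> is nonzero makes \<open>f\<close> a constant multiple \<open>c\<close> of
  \<open>g\<close>. Substituting this into a row at a point where \<open>g\<close> is nonzero gives \<open>|c| = 1\<close>. If neither
  function is nonzero on a set of positive measure, any phase will do.
\<close>

lemma AE_phase_if_AE_tensor_eq:
  fixes f g :: "real \<Rightarrow> complex"
  assumes "AE z in lborel. f (fst z) * cnj (f (snd z)) = g (fst z) * cnj (g (snd z))"
  shows "\<exists>\<alpha>::real. AE t in lborel. f t = exp (\<i> * of_real \<alpha>) * g t"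
proof -
  have rows: "AE s in lborel. AE t in lborel. f s * cnj (f t) = g s * cnj (g t)"
    using lborel_pair.AE_pair[OF assms[folded lborel_prod]] by simp
  show ?thesis
  proof (cases "AE s in lborel. f s = 0 \<and> g s = 0")
    case True
    then have "AE t in lborel. f t = exp (\<i> * of_real 0) * g t"
      by eventually_elim simp
    then show ?thesis by blast
  next
    case False
    note not_both_zero = False
    \<comment> \<open>Stated for arbitrary \<open>f\<close> and \<open>g\<close>, so that it can also be applied with their roles exchanged.\<close>
    have phase: "\<exists>\<alpha>::real. AE t in lborel. f t = exp (\<i> * of_real \<alpha>) * g t"
      if rows: "AE s in lborel. AE t in lborel. f s * cnj (f t) = g s * cnj (g t)"
        and nonzero: "\<not> (AE s in lborel. f s = 0 \<and> g s = 0)"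
        and s: "AE t in lborel. f s * cnj (f t) = g s * cnj (g t)" "f s \<noteq> 0"
      for f g :: "real \<Rightarrow> complex" and s
    proof -
      define c where "c = cnj (g s / f s)"
      have proportional: "AE t in lborel. f t = c * g t"
        using s(1)
      proof eventually_elim
        case (elim t)
        then have "cnj (f t) = cnj (c * g t)"
          using s(2) by (simp add: c_def field_simps)
        then show ?case by (simp only: complex_cnj_cancel_iff)
      qed
      have g_nonzero: "\<not> (AE t in lborel. g t = 0)"
      proof
        assume "AE t in lborel. g t = 0"
        with proportional have "AE t in lborel. f t = 0 \<and> g t = 0"
          by eventually_elim simp
        with nonzero show False by contradiction
      qed
      have "\<exists>s. f s = c * g s \<and> (AE t in lborel. f s * cnj (f t) = g s * cnj (g t)) \<and> g s \<noteq> 0"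
      proof (rule ccontr)
        assume none: "\<not> ?thesis"
        from proportional rows have "AE t in lborel. g t = 0"
          by eventually_elim (use none in blast)
        with g_nonzero show False by contradiction
      qed
      then obtain s' where s': "f s' = c * g s'" "g s' \<noteq> 0"
        "AE t in lborel. f s' * cnj (f t) = g s' * cnj (g t)"
        by blast
      have "c * cnj c = 1"
      proof (rule ccontr)
        assume c: "c * cnj c \<noteq> 1"
        from proportional s'(3) have "AE t in lborel. g t = 0"
        proof eventually_elim
          case (elim t)
          then have "g s' * ((c * cnj c - 1) * cnj (g t)) = 0"
            by (simp add: s'(1) algebra_simps)
          then show ?case
            using c s'(2) by simp
        qed
        with g_nonzero show False by contradiction
      qed
      then have "complex_of_real ((cmod c)\<^sup>2) = of_real 1"
        unfolding complex_norm_square by simp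
      then have "cmod c = 1"
        unfolding of_real_eq_iff using norm_ge_zero[of c] by (simp add: power2_eq_1_iff)
      then obtain \<alpha> where \<alpha>: "c = exp (\<i> * of_real \<alpha>)"
        using cis_Arg[of c] by (cases "c = 0") (auto simp: cis_conv_exp sgn_eq intro: that[of "Arg c"])
      show ?thesis
        using proportional unfolding \<alpha> by blast
    qed
    have "\<exists>s. (AE t in lborel. f s * cnj (f t) = g s * cnj (g t)) \<and> (f s \<noteq> 0 \<or> g s \<noteq> 0)"
    proof (rule ccontr)
      assume none: "\<not> ?thesis"
      from rows have "AE s in lborel. f s = 0 \<and> g s = 0"
        by eventually_elim (use none in blast)
      with False show False by contradiction
    qed
    then obtain s where s: "AE t in lborel. f s * cnj (f t) = g s * cnj (g t)" "f s \<noteq> 0 \<or> g s \<noteq> 0"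
      by blast
    show ?thesis
    proof (cases "f s = 0")
      case False
      then show ?thesis using phase[OF rows not_both_zero s(1)] by blast
    next
      case True
      have "AE s in lborel. AE t in lborel. g s * cnj (g t) = f s * cnj (f t)"
        using rows by (elim eventually_mono) (simp add: eventually_mono)
      moreover have "AE t in lborel. g s * cnj (g t) = f s * cnj (f t)"
        using s(1) by (simp add: eventually_mono)
      moreover have "\<not> (AE s in lborel. g s = 0 \<and> f s = 0)"
        using not_both_zero by (simp add: conj_commute)
      ultimately have "\<exists>\<alpha>::real. AE t in lborel. g t = exp (\<i> * of_real \<alpha>) * f t"
        using phase[of g f s] s(2) True by blast
      then obtain \<alpha> :: real where "AE t in lborel. g t = exp (\<i> * of_real \<alpha>) * f t"
        by blast
      then have "AE t in lborel. f t = exp (\<i> * of_real (- \<alpha>)) * g t"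
        by eventually_elim (simp add: exp_minus)
      then show ?thesis by blast
    qed
  qed
qed

section \<open>The Gabor transform\<close>

lemma
  fixes f g :: "real \<Rightarrow> complex"
  assumes f: "integrable lborel f" and g: "integrable lborel g"
  shows integrable_lborel_tensor: "integrable lborel (\<lambda>z. f (fst z) * g (snd z))" (is ?int)
    and integral_lborel_tensor: "(\<integral>z. f (fst z) * g (snd z) \<partial>lborel) = (\<integral>t. f t \<partial>lborel) * (\<integral>t. g t \<partial>lborel)" (is ?eq)
proof -
  have [measurable]: "f \<in> borel_measurable borel" "g \<in> borel_measurable borel"
    using f g by auto
  have int: "integrable (lborel \<Otimes>\<^sub>M lborel) (\<lambda>z. f (fst z) * g (snd z))"
    using f g by (intro lborel_pair.Fubini_integrable) (auto simp: norm_mult)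
  then show ?int by (simp add: lborel_prod)
  show ?eq
    using lborel_pair.integral_fst'[OF int] by (simp add: lborel_prod)
qed

lemma Gabor_cong_AE:
  assumes "f \<in> borel_measurable lebesgue" "g \<in> borel_measurable lebesgue" "AE t in lebesgue. f t = g t"
  shows "Gabor f x \<omega> = Gabor g x \<omega>"
proof -
  have w: "(\<lambda>t. complex_of_real (exp (- pi * (t - x)\<^sup>2))) \<in> borel_measurable lebesgue"
     "(\<lambda>t. exp (- 2 * complex_of_real pi * \<i> * complex_of_real t * complex_of_real \<omega>)) \<in> borel_measurable lebesgue"
    by (intro measurable_completion; simp)+
  show ?thesis
    unfolding Gabor_def using assms
    by (intro arg_cong2[where f = "(*)"] refl integral_cong_AE borel_measurable_times w)
       (auto elim!: eventually_mono)
qed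

text \<open>
  The squared modulus of an integral is the integral of the rank-one kernel of the integrand. This
  makes the phaseless measurement linear in \<open>F(u) cnj (F(t))\<close>.
\<close>

lemma cmod_Gabor_squared:
  fixes F :: "real \<Rightarrow> complex"
  assumes F [measurable]: "F \<in> borel_measurable borel" and int: "integrable lborel F"
  shows "of_real ((cmod (Gabor F x \<omega>))\<^sup>2) = of_real ((2 powr (1/4))\<^sup>2) *
    (\<integral>z. F (fst z) * cnj (F (snd z)) * (of_real (exp (- pi * ((fst z - x)\<^sup>2 + (snd z - x)\<^sup>2)))
           * cis (- 2 * pi * \<omega> * (fst z - snd z))) \<partial>lborel)"
proof -
  define a where "a t = F t * complex_of_real (exp (- pi * (t - x)\<^sup>2))
            * exp (- 2 * complex_of_real pi * \<i> * complex_of_real t * complex_of_real \<omega>)" for t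
  have a_cis: "a t = F t * complex_of_real (exp (- pi * (t - x)\<^sup>2)) * cis (- 2 * pi * t * \<omega>)" for t
    by (simp add: a_def cis_conv_exp mult_ac)
  have [measurable]: "a \<in> borel_measurable borel"
    unfolding a_def by measurable
  have int_a: "integrable lborel a"
    by (rule Bochner_Integration.integrable_bound[OF int])
       (auto simp: a_cis norm_mult intro!: AE_I2 mult_left_le)
  have G: "Gabor F x \<omega> = of_real (2 powr (1/4)) * (\<integral>t. a t \<partial>lborel)"
    unfolding Gabor_def a_def[symmetric] by (simp add: integral_completion)
  have kernel: "a u * cnj (a t) = F u * cnj (F t) * (of_real (exp (- pi * ((u - x)\<^sup>2 + (t - x)\<^sup>2)))
           * cis (- 2 * pi * \<omega> * (u - t)))" for u t
  proof -
    have "cis (- 2 * pi * \<omega> * (u - t)) = cis (- 2 * pi * u * \<omega>) * cis (2 * pi * t * \<omega>)"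
      by (simp add: cis_mult algebra_simps)
    moreover have "exp (- pi * ((u - x)\<^sup>2 + (t - x)\<^sup>2)) = exp (- pi * (u - x)\<^sup>2) * exp (- pi * (t - x)\<^sup>2)"
      by (simp add: exp_add[symmetric] algebra_simps)
    ultimately show ?thesis
      by (simp add: a_cis cis_cnj mult_ac)
  qed
  have "of_real ((cmod (Gabor F x \<omega>))\<^sup>2)
      = of_real ((2 powr (1/4))\<^sup>2) * ((\<integral>t. a t \<partial>lborel) * (\<integral>t. cnj (a t) \<partial>lborel))"
    unfolding complex_norm_square G by (simp add: power2_eq_square mult_ac)
  also have "(\<integral>t. a t \<partial>lborel) * (\<integral>t. cnj (a t) \<partial>lborel) = (\<integral>z. a (fst z) * cnj (a (snd z)) \<partial>lborel)"
    using int_a by (subst integral_lborel_tensor[of a "\<lambda>t. cnj (a t)"]) auto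
  finally show ?thesis
    by (simp only: kernel)
qed

lemma Gabor_cmult: "Gabor (\<lambda>t. c * f t) x \<omega> = c * Gabor f x \<omega>"
  unfolding Gabor_def mult.assoc integral_mult_right_zero by (rule mult.left_commute)

text \<open>
  Sample points with \<open>n \<ge> 1\<close> yield only positive powers of \<open>exp (2\<pi>(u+t))\<close>, which do not contain
  the constants. One of these powers is therefore absorbed into the positive weight of \<open>H\<close>, and the
  sample at \<open>n + 1\<close> becomes the moment of order \<open>n\<close>. The sign of \<open>k\<close> is reversed by the Fourier
  kernel.
\<close>

lemma AE_tensor_eq_if_Gabor_samples_eq:
  fixes F G :: "real \<Rightarrow> complex"
  assumes F: "F \<in> borel_measurable borel" "integrable lborel F" "\<And>t. t \<notin> {-B..B} \<Longrightarrow> F t = 0"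
    and G: "G \<in> borel_measurable borel" "integrable lborel G" "\<And>t. t \<notin> {-B..B} \<Longrightarrow> G t = 0"
    and b: "0 < b" "4 * B * b < 1"
    and samples: "\<And>(n::nat) (k::int). 1 \<le> n \<Longrightarrow>
      cmod (Gabor F (real n) (b * of_int k)) = cmod (Gabor G (real n) (b * of_int k))"
  shows "AE z in lborel. F (fst z) * cnj (F (snd z)) = G (fst z) * cnj (G (snd z))"
proof -
  define W where "W z = F (fst z) * cnj (F (snd z)) - G (fst z) * cnj (G (snd z))" for z
  define H where "H z = W z * of_real (exp (- pi * ((fst z)\<^sup>2 + (snd z)\<^sup>2) + 2 * pi * (fst z + snd z)))" for z
  define w where "w n k z = complex_of_real (exp (- pi * ((fst z - real n)\<^sup>2 + (snd z - real n)\<^sup>2)))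
      * cis (- 2 * pi * (b * of_int k) * (fst z - snd z))" for n :: nat and k :: int and z
  have K: "compact ({-B..B} \<times> {-B..B})"
    by (intro compact_Times compact_Icc)
  have int_F: "integrable lborel (\<lambda>z. F (fst z) * cnj (F (snd z)))"
    using F integrable_lborel_tensor[of F "\<lambda>t. cnj (F t)"] by simp
  have int_G: "integrable lborel (\<lambda>z. G (fst z) * cnj (G (snd z)))"
    using G integrable_lborel_tensor[of G "\<lambda>t. cnj (G t)"] by simp
  have supp_F: "F (fst z) * cnj (F (snd z)) = 0" and supp_G: "G (fst z) * cnj (G (snd z)) = 0"
    if "z \<notin> {-B..B} \<times> {-B..B}" for z
    using that F(3) G(3) by (auto simp: mem_Times_iff)
  have int_W: "integrable lborel W"
    unfolding W_def using int_F int_G by simp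
  have supp_W: "W z = 0" if "z \<notin> {-B..B} \<times> {-B..B}" for z
    unfolding W_def supp_F[OF that] supp_G[OF that] by simp
  have int_H: "integrable lborel H"
    unfolding H_def by (rule integrable_mult_continuous_compact_support[OF int_W K supp_W])
      (auto intro!: continuous_intros)
  have W_zero: "(\<integral>z. W z * w n k z \<partial>lborel) = 0" if "1 \<le> n" for n k
  proof -
    have cont: "continuous_on UNIV (w n k)"
      unfolding w_def by (intro continuous_intros)
    have "complex_of_real ((cmod (Gabor F (real n) (b * of_int k)))\<^sup>2) = of_real ((cmod (Gabor G (real n) (b * of_int k)))\<^sup>2)"
      using samples[OF that] by simp
    then have "(\<integral>z. F (fst z) * cnj (F (snd z)) * w n k z \<partial>lborel) = (\<integral>z. G (fst z) * cnj (G (snd z)) * w n k z \<partial>lborel)"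
      unfolding cmod_Gabor_squared[OF F(1,2)] cmod_Gabor_squared[OF G(1,2)] w_def by simp
    moreover have "integrable lborel (\<lambda>z. F (fst z) * cnj (F (snd z)) * w n k z)"
      "integrable lborel (\<lambda>z. G (fst z) * cnj (G (snd z)) * w n k z)"
      using integrable_mult_continuous_compact_support[OF int_F K supp_F cont]
        integrable_mult_continuous_compact_support[OF int_G K supp_G cont] by auto
    ultimately show ?thesis
      by (simp add: W_def left_diff_distrib Bochner_Integration.integral_diff)
  qed
  have "AE z in lborel. H z = 0"
  proof (rule AE_eq_0_if_exp_trig_moments_eq_0[OF int_H _ b])
    show "H z = 0" if "z \<notin> {-B..B} \<times> {-B..B}" for z
      using supp_W[OF that] by (simp add: H_def)
    fix n :: nat and k :: int
    \<comment> \<open>The factor that completes the square in both variables at the sample point.\<close>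
    define c where "c = exp (2 * pi * (real (Suc n))\<^sup>2)"
    have "H z * (of_real (exp (2 * pi * real n * (fst z + snd z))) * cis (2 * pi * b * of_int k * (fst z - snd z)))
        = of_real c * (W z * w (Suc n) (- k) z)" for z
    proof -
      have "exp (- pi * ((fst z)\<^sup>2 + (snd z)\<^sup>2) + 2 * pi * (fst z + snd z)) * exp (2 * pi * real n * (fst z + snd z))
          = c * exp (- pi * ((fst z - real (Suc n))\<^sup>2 + (snd z - real (Suc n))\<^sup>2))"
        unfolding c_def exp_add[symmetric]
        by (rule arg_cong[where f = exp]) (simp add: power2_eq_square algebra_simps)
      then have "complex_of_real (exp (- pi * ((fst z)\<^sup>2 + (snd z)\<^sup>2) + 2 * pi * (fst z + snd z))) * of_real (exp (2 * pi * real n * (fst z + snd z)))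
          = of_real c * of_real (exp (- pi * ((fst z - real (Suc n))\<^sup>2 + (snd z - real (Suc n))\<^sup>2)))"
        unfolding of_real_mult[symmetric] by (rule arg_cong)
      then show ?thesis
        unfolding H_def w_def by (simp add: mult_ac del: of_real_exp)
    qed
    then show "(\<integral>z. H z * (of_real (exp (2 * pi * real n * (fst z + snd z)))
        * cis (2 * pi * b * of_int k * (fst z - snd z))) \<partial>lborel) = 0"
      using W_zero[of "Suc n" "- k"] by simp
  qed
  then show ?thesis
    by eventually_elim (simp add: H_def W_def)
qed

theorem theorem1p1:
  fixes p :: ennreal and B b :: real and f g :: "real \<Rightarrow> complex"
  assumes "1 \<le> p" and "B > 0" and "b \<in> {0<..<1 / (4 * B)}"
    and "f \<in> Lp_interval p B" and "g \<in> Lp_interval p B"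
  shows "(\<exists>\<alpha>::real. AE t in lebesgue. f t = exp (\<i> * complex_of_real \<alpha>) * g t) \<longleftrightarrow>
         (\<forall>(x, \<omega>) \<in> {real n | n::nat. n \<ge> 1} \<times> {b * real_of_int k | k::int. True}.
            cmod (Gabor f x \<omega>) = cmod (Gabor g x \<omega>))"
proof
  have meas: "f \<in> borel_measurable lebesgue" "g \<in> borel_measurable lebesgue"
    using assms by (auto simp: Lp_interval_def Lp_space_def)
  {
    assume "\<exists>\<alpha>::real. AE t in lebesgue. f t = exp (\<i> * complex_of_real \<alpha>) * g t"
    then obtain \<alpha> :: real where \<alpha>: "AE t in lebesgue. f t = exp (\<i> * complex_of_real \<alpha>) * g t"
      by blast
    have "Gabor f x \<omega> = exp (\<i> * complex_of_real \<alpha>) * Gabor g x \<omega>" for x \<omega>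
      unfolding Gabor_cmult[symmetric] using meas \<alpha> by (intro Gabor_cong_AE) auto
    then show "\<forall>(x, \<omega>) \<in> {real n | n::nat. n \<ge> 1} \<times> {b * real_of_int k | k::int. True}.
            cmod (Gabor f x \<omega>) = cmod (Gabor g x \<omega>)"
      by (simp add: norm_mult)
  }
  assume samples: "\<forall>(x, \<omega>) \<in> {real n | n::nat. n \<ge> 1} \<times> {b * real_of_int k | k::int. True}.
            cmod (Gabor f x \<omega>) = cmod (Gabor g x \<omega>)"
  obtain F where F: "F \<in> borel_measurable borel" "integrable lborel F"
    "\<And>t. t \<notin> {-B..B} \<Longrightarrow> F t = 0" and f_F: "AE t in lebesgue. f t = F t"
    using borel_representative_on_interval[OF integrable_if_Lp_interval[OF assms(1,4)], of B] assms(4)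
    by (auto simp: Lp_interval_def)
  obtain G where G: "G \<in> borel_measurable borel" "integrable lborel G"
    "\<And>t. t \<notin> {-B..B} \<Longrightarrow> G t = 0" and g_G: "AE t in lebesgue. g t = G t"
    using borel_representative_on_interval[OF integrable_if_Lp_interval[OF assms(1,5)], of B] assms(5)
    by (auto simp: Lp_interval_def)
  have "F \<in> borel_measurable lebesgue" "G \<in> borel_measurable lebesgue"
    using F(1) G(1) by (auto intro!: measurable_completion)
  then have Gabor_eq: "Gabor f = Gabor F" "Gabor g = Gabor G"
    using meas f_F g_G by (auto intro!: ext Gabor_cong_AE)
  have "AE z in lborel. F (fst z) * cnj (F (snd z)) = G (fst z) * cnj (G (snd z))"
  proof (rule AE_tensor_eq_if_Gabor_samples_eq[OF F G])
    show "0 < b" "4 * B * b < 1"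
      using assms(2,3) by (auto simp: field_simps)
    show "cmod (Gabor F (real n) (b * of_int k)) = cmod (Gabor G (real n) (b * of_int k))"
      if "1 \<le> n" for n :: nat and k :: int
      using samples that unfolding Gabor_eq by blast
  qed
  then obtain \<alpha> :: real where "AE t in lborel. F t = exp (\<i> * of_real \<alpha>) * G t"
    using AE_phase_if_AE_tensor_eq by blast
  then have "AE t in lebesgue. F t = exp (\<i> * of_real \<alpha>) * G t"
    by (rule AE_completion)
  with f_F g_G have "AE t in lebesgue. f t = exp (\<i> * complex_of_real \<alpha>) * g t"
    by eventually_elim simp
  then show "\<exists>\<alpha>::real. AE t in lebesgue. f t = exp (\<i> * complex_of_real \<alpha>) * g t"
    by blast
qed

end
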